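(* Let $E$ be an admissible $*$-tring. Then the maps $\Phi_r:\mathcal{SN}(E)\to\mathcal{SN}_{cs}(E_0^r)$, $\Phi_r(\gamma)=\gamma^r$, and $\Psi_r:\mathcal{SN}_{cs}(E_0^r)\to\mathcal{SN}(E)$, $\Psi_r(\alpha)=\tilde\alpha$, where $$\gamma^r(a)=\sup\{\gamma(xa): x\in E,\ \gamma(x)\le 1\}\ (a\in E_0^r),\qquad \tilde\alpha(x)=\alpha(\langle x,x\rangle_r)^{1/2}\ (x\in E),$$ are mutually inverse isomorphisms of lattices. Moreover $\Phi_r(\mathcal{N}(E))=\mathcal{N}_{cs}(E_0^r)$ and $\Psi_r(\mathcal{N}_{cs}(E_0^r))=\mathcal{N}(E)$.
   Context: A $*$-ternary ring ($*$-tring) is a complex vector space $E$ with a map $(\cdot,\cdot,\cdot):E\times E\times E\to E$, linear in the first and third variables and conjugate linear in the second, such that $((x,y,z),u,v)=(x,(u,z,y),v)=(x,y,(z,u,v))$ for all $x,y,z,u,v\in E$. It is admissible if $(x,x,x)=0$ implies $x=0$. For an admissible $*$-tring $E$ let $\theta_{y,z}:E\to E$, $\theta_{y,z}(x)=(x,y,z)$. Then $E_0^r=\mathrm{span}\{\theta_{y,z}:y,z\in E\}$ is a $*$-algebra with product opposite to composition of maps and involution determined by $\theta_{y,z}^*=\theta_{z,y}$; $E$ is a right $E_0^r$-module via $xT=T(x)$; and $\langle y,z\rangle_r:=\theta_{y,z}$, so that $x\langle y,z\rangle_r=(x,y,z)$. A $C^*$-seminorm on a $*$-tring $E$ is a seminorm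 $\gamma$ with $\gamma((x,y,z))\le\gamma(x)\gamma(y)\gamma(z)$ and $\gamma((x,x,x))=\gamma(x)^3$ for all $x,y,z\in E$; it is a $C^*$-norm if it is a norm. A $C^*$-seminorm on a $*$-algebra is a submultiplicative seminorm $\alpha$ with $\alpha(a^*a)=\alpha(a)^2$. $\mathcal{SN}(\cdot)$ and $\mathcal{N}(\cdot)$ denote the sets of $C^*$-seminorms and of $C^*$-norms on a $*$-tring or $*$-algebra, ordered pointwise. Finally $$\mathcal{SN}_{cs}(E_0^r)=\{\alpha\in\mathcal{SN}(E_0^r):\alpha(\langle x,y\rangle_r)^2\le\alpha(\langle x,x\rangle_r)\,\alpha(\langle y,y\rangle_r)\ \forall x,y\in E\},$$ and $\mathcal{N}_{cs}(E_0^r)=\mathcal{SN}_{cs}(E_0^r)\cap\mathcal{N}(E_0^r)$. *)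

theory Defs
  imports Complex_Main "HOL-Library.FuncSet" "HOL-Library.Function_Algebras" "HOL-Algebra.Lattice"
begin

section \<open>Admissible star-ternary rings\<close>

text \<open>The complex vector space \<open>E\<close> is the type \<open>'e\<close> with scalar multiplication \<open>s\<close>;
  \<open>t x y z\<close> is the triple product \<open>(x, y, z)\<close>.\<close>

locale star_tring = vector_space s
  for s :: "complex \<Rightarrow> 'e::ab_group_add \<Rightarrow> 'e" +
  fixes t :: "'e \<Rightarrow> 'e \<Rightarrow> 'e \<Rightarrow> 'e"
  assumes linear_fst: "Vector_Spaces.linear s s (\<lambda>x. t x y z)"
    and additive_snd: "t x (y + y') z = t x y z + t x y' z"
    and conj_scale_snd: "t x (s c y) z = s (cnj c) (t x y z)"
    and linear_trd: "Vector_Spaces.linear s s (\<lambda>z. t x y z)"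
    and assoc_left_mid: "t (t x y z) u v = t x (t u z y) v"
    and assoc_left_right: "t (t x y z) u v = t x y (t z u v)"

locale admissible_star_tring = star_tring +
  assumes admissible: "t x x x = 0 \<Longrightarrow> x = 0"


section \<open>The star-algebra acting from the right\<close>

definition fun_scale :: "(complex \<Rightarrow> 'e \<Rightarrow> 'e) \<Rightarrow> complex \<Rightarrow> ('e \<Rightarrow> 'e) \<Rightarrow> ('e \<Rightarrow> 'e)"
  where "fun_scale s c f = (\<lambda>x. s c (f x))"

definition theta :: "('e \<Rightarrow> 'e \<Rightarrow> 'e \<Rightarrow> 'e) \<Rightarrow> 'e \<Rightarrow> 'e \<Rightarrow> ('e \<Rightarrow> 'e)"
  where "theta t y z = (\<lambda>x. t x y z)"

text \<open>The inner product \<open>\<langle>y, z\<rangle>\<^sub>r\<close> is \<open>theta t y z\<close>, and the right action of an operator \<open>a\<close>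
  is \<open>xa = a x\<close>. Addition of operators is the pointwise addition of
  \<^theory>\<open>HOL-Library.Function_Algebras\<close> (whose pointwise multiplication plays no role here).\<close>

definition E0r :: "(complex \<Rightarrow> 'e::ab_group_add \<Rightarrow> 'e) \<Rightarrow> ('e \<Rightarrow> 'e \<Rightarrow> 'e \<Rightarrow> 'e) \<Rightarrow> ('e \<Rightarrow> 'e) set"
  where "E0r s t = module.span (fun_scale s) {theta t y z | y z. True}"

definition mult_r :: "('e \<Rightarrow> 'e) \<Rightarrow> ('e \<Rightarrow> 'e) \<Rightarrow> ('e \<Rightarrow> 'e)"
  where "mult_r a b = b \<circ> a"

definition involution_on ::
  "(complex \<Rightarrow> 'a::ab_group_add \<Rightarrow> 'a) \<Rightarrow> 'a set \<Rightarrow> ('a \<Rightarrow> 'a \<Rightarrow> 'a) \<Rightarrow> ('a \<Rightarrow> 'a) \<Rightarrow> bool"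
  where "involution_on s A m J \<longleftrightarrow>
    (\<forall>a\<in>A. J a \<in> A) \<and>
    (\<forall>a\<in>A. \<forall>b\<in>A. J (a + b) = J a + J b) \<and>
    (\<forall>c. \<forall>a\<in>A. J (s c a) = s (cnj c) (J a)) \<and>
    (\<forall>a\<in>A. J (J a) = a) \<and>
    (\<forall>a\<in>A. \<forall>b\<in>A. J (m a b) = m (J b) (J a))"

text \<open>Existence and uniqueness of the involution on an admissible star-tring is
  \<open>ex1_star_r\<close> below.\<close>

definition star_r :: "(complex \<Rightarrow> 'e::ab_group_add \<Rightarrow> 'e) \<Rightarrow> ('e \<Rightarrow> 'e \<Rightarrow> 'e \<Rightarrow> 'e) \<Rightarrow>
    ('e \<Rightarrow> 'e) \<Rightarrow> ('e \<Rightarrow> 'e)"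
  where "star_r s t = (THE J. J \<in> extensional (E0r s t) \<and>
    involution_on (fun_scale s) (E0r s t) mult_r J \<and>
    (\<forall>y z. J (theta t y z) = theta t z y))"


section \<open>C*-seminorms\<close>

definition seminorm_on :: "(complex \<Rightarrow> 'a::ab_group_add \<Rightarrow> 'a) \<Rightarrow> 'a set \<Rightarrow> ('a \<Rightarrow> real) \<Rightarrow> bool"
  where "seminorm_on s V p \<longleftrightarrow>
    (\<forall>x\<in>V. 0 \<le> p x) \<and>
    (\<forall>x\<in>V. \<forall>y\<in>V. p (x + y) \<le> p x + p y) \<and>
    (\<forall>c. \<forall>x\<in>V. p (s c x) = cmod c * p x)"

definition SN_tring :: "(complex \<Rightarrow> 'e::ab_group_add \<Rightarrow> 'e) \<Rightarrow> ('e \<Rightarrow> 'e \<Rightarrow> 'e \<Rightarrow> 'e) \<Rightarrow> ('e \<Rightarrow> real) set"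
  where "SN_tring s t = {\<gamma>. seminorm_on s UNIV \<gamma> \<and>
    (\<forall>x y z. \<gamma> (t x y z) \<le> \<gamma> x * \<gamma> y * \<gamma> z) \<and>
    (\<forall>x. \<gamma> (t x x x) = \<gamma> x ^ 3)}"

definition N_tring :: "(complex \<Rightarrow> 'e::ab_group_add \<Rightarrow> 'e) \<Rightarrow> ('e \<Rightarrow> 'e \<Rightarrow> 'e \<Rightarrow> 'e) \<Rightarrow> ('e \<Rightarrow> real) set"
  where "N_tring s t = {\<gamma> \<in> SN_tring s t. \<forall>x. \<gamma> x = 0 \<longrightarrow> x = 0}"

text \<open>A star-algebra is given by its carrier \<open>A\<close>, scalar multiplication \<open>s\<close>, product \<open>m\<close> and
  involution \<open>J\<close>. A seminorm on \<open>A\<close> is a function defined on \<open>A\<close> only, hence \<open>extensional\<close>.\<close>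

definition SN_alg :: "(complex \<Rightarrow> 'a::ab_group_add \<Rightarrow> 'a) \<Rightarrow> 'a set \<Rightarrow> ('a \<Rightarrow> 'a \<Rightarrow> 'a) \<Rightarrow> ('a \<Rightarrow> 'a) \<Rightarrow>
    ('a \<Rightarrow> real) set"
  where "SN_alg s A m J = {\<alpha> \<in> extensional A. seminorm_on s A \<alpha> \<and>
    (\<forall>a\<in>A. \<forall>b\<in>A. \<alpha> (m a b) \<le> \<alpha> a * \<alpha> b) \<and>
    (\<forall>a\<in>A. \<alpha> (m (J a) a) = (\<alpha> a)\<^sup>2)}"

definition N_alg :: "(complex \<Rightarrow> 'a::ab_group_add \<Rightarrow> 'a) \<Rightarrow> 'a set \<Rightarrow> ('a \<Rightarrow> 'a \<Rightarrow> 'a) \<Rightarrow> ('a \<Rightarrow> 'a) \<Rightarrow>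
    ('a \<Rightarrow> real) set"
  where "N_alg s A m J = {\<alpha> \<in> SN_alg s A m J. \<forall>a\<in>A. \<alpha> a = 0 \<longrightarrow> a = 0}"

definition SN_cs :: "(complex \<Rightarrow> 'e::ab_group_add \<Rightarrow> 'e) \<Rightarrow> ('e \<Rightarrow> 'e \<Rightarrow> 'e \<Rightarrow> 'e) \<Rightarrow>
    (('e \<Rightarrow> 'e) \<Rightarrow> real) set"
  where "SN_cs s t = {\<alpha> \<in> SN_alg (fun_scale s) (E0r s t) mult_r (star_r s t).
    \<forall>x y. (\<alpha> (theta t x y))\<^sup>2 \<le> \<alpha> (theta t x x) * \<alpha> (theta t y y)}"

definition N_cs :: "(complex \<Rightarrow> 'e::ab_group_add \<Rightarrow> 'e) \<Rightarrow> ('e \<Rightarrow> 'e \<Rightarrow> 'e \<Rightarrow> 'e) \<Rightarrow>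
    (('e \<Rightarrow> 'e) \<Rightarrow> real) set"
  where "N_cs s t = SN_cs s t \<inter> N_alg (fun_scale s) (E0r s t) mult_r (star_r s t)"

text \<open>The set \<open>F\<close> of functions on \<open>A\<close> as a poset under the pointwise order.\<close>

definition pointwise_order :: "'a set \<Rightarrow> ('a \<Rightarrow> real) set \<Rightarrow> ('a \<Rightarrow> real) gorder"
  where "pointwise_order A F =
    \<lparr>carrier = F, eq = (=), le = (\<lambda>f g. \<forall>a\<in>A. f a \<le> g a)\<rparr>"

text \<open>\<^const>\<open>join_pres\<close> and \<^const>\<open>meet_pres\<close> also assert that both posets are lattices.\<close>

definition lattice_iso :: "('a, 'c) gorder_scheme \<Rightarrow> ('b, 'd) gorder_scheme \<Rightarrow> ('a \<Rightarrow> 'b) \<Rightarrow> bool"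
  where "lattice_iso L M f \<longleftrightarrow>
    bij_betw f (carrier L) (carrier M) \<and> join_pres L M f \<and> meet_pres L M f"


section \<open>The two maps\<close>

text \<open>The supremum is over a nonempty bounded set, see \<open>bdd_above_Phi_r\<close> below.\<close>

definition Phi_r :: "(complex \<Rightarrow> 'e::ab_group_add \<Rightarrow> 'e) \<Rightarrow> ('e \<Rightarrow> 'e \<Rightarrow> 'e \<Rightarrow> 'e) \<Rightarrow>
    ('e \<Rightarrow> real) \<Rightarrow> (('e \<Rightarrow> 'e) \<Rightarrow> real)"
  where "Phi_r s t \<gamma> = (\<lambda>a\<in>E0r s t. SUP x\<in>{x. \<gamma> x \<le> 1}. \<gamma> (a x))"

definition Psi_r :: "('e \<Rightarrow> 'e \<Rightarrow> 'e \<Rightarrow> 'e) \<Rightarrow> (('e \<Rightarrow> 'e) \<Rightarrow> real) \<Rightarrow> ('e \<Rightarrow> real)"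
  where "Psi_r t \<alpha> = (\<lambda>x. sqrt (\<alpha> (theta t x x)))"


section \<open>Well-definedness\<close>

context star_tring
begin

lemma vector_space_fun_scale: "vector_space (fun_scale s)"
  by unfold_locales
    (auto simp: fun_scale_def fun_eq_iff scale_right_distrib scale_left_distrib)

sublocale ops: vector_space "fun_scale s"
  by (rule vector_space_fun_scale)

lemma add_fst: "t (x + x') y z = t x y z + t x' y z"
  using module_hom.add[OF Vector_Spaces.linear.axioms(3)[OF linear_fst[of y z]]] .

lemma scale_fst: "t (s c x) y z = s c (t x y z)"
  using module_hom.scale[OF Vector_Spaces.linear.axioms(3)[OF linear_fst[of y z]]] .

lemma add_trd: "t x y (z + z') = t x y z + t x y z'"
  using module_hom.add[OF Vector_Spaces.linear.axioms(3)[OF linear_trd[of x y]]] .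

lemma scale_trd: "t x y (s c z) = s c (t x y z)"
  using module_hom.scale[OF Vector_Spaces.linear.axioms(3)[OF linear_trd[of x y]]] .

lemma zero_fst: "t 0 y z = 0" and zero_snd: "t x 0 z = 0" and zero_trd: "t x y 0 = 0"
  using add_fst[of 0 0 y z] additive_snd[of x 0 0 z] add_trd[of x y 0 0] by auto

lemma theta_in_E0r: "theta t y z \<in> E0r s t"
  by (auto simp: E0r_def intro: ops.span_base)

lemma E0r_zero: "0 \<in> E0r s t"
  by (simp add: E0r_def ops.span_zero)

lemma E0r_add: "a \<in> E0r s t \<Longrightarrow> b \<in> E0r s t \<Longrightarrow> a + b \<in> E0r s t"
  by (simp add: E0r_def ops.span_add)

lemma E0r_scale: "a \<in> E0r s t \<Longrightarrow> fun_scale s c a \<in> E0r s t"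
  by (simp add: E0r_def ops.span_scale)

lemma E0r_induct [consumes 1, case_names zero step]:
  assumes "a \<in> E0r s t" "P 0"
    and "\<And>c y z a. a \<in> E0r s t \<Longrightarrow> P a \<Longrightarrow> P (fun_scale s c (theta t y z) + a)"
  shows "P a"
proof -
  have "a \<in> E0r s t \<and> P a"
    using assms(1) unfolding E0r_def
  proof (induction rule: ops.span_induct_alt)
    case base
    show ?case using E0r_zero assms(2) unfolding E0r_def by (rule conjI)
  next
    case (step c x y)
    then obtain u v where x: "x = theta t u v" by auto
    have y: "y \<in> E0r s t" "P y" using step by (auto simp: E0r_def)
    show ?case
      using assms(3)[OF y] E0r_add[OF E0r_scale[OF theta_in_E0r] y(1)]
      unfolding x E0r_def[symmetric] by (rule conjI[rotated])
  qed
  then show ?thesis ..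
qed

lemma E0r_linear:
  assumes "a \<in> E0r s t"
  shows "a (x + y) = a x + a y" "a (s c x) = s c (a x)"
  using assms
  by (induction rule: E0r_induct)
    (auto simp: fun_scale_def theta_def add_fst scale_fst scale_right_distrib scale_left_commute)

lemma E0r_mult:
  assumes "a \<in> E0r s t" "b \<in> E0r s t"
  shows "mult_r a b \<in> E0r s t"
  using assms(1)
proof (induction rule: E0r_induct)
  case zero
  have "mult_r 0 b = 0"
    using E0r_linear(2)[OF assms(2), of 0] by (auto simp: mult_r_def fun_eq_iff)
  then show ?case using E0r_zero by metis
next
  case (step c y z a)
  have *: "b (t x y z) = t x y (b z)" for x
    using assms(2)
    by (induction rule: E0r_induct)
      (auto simp: zero_fst add_trd scale_trd fun_scale_def theta_def assoc_left_right
        zero_trd)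
  have "mult_r (fun_scale s c (theta t y z) + a) b =
      fun_scale s c (theta t y (b z)) + mult_r a b"
    by (auto simp: mult_r_def fun_eq_iff E0r_linear[OF assms(2)] fun_scale_def theta_def *)
  then show ?case using step by (metis E0r_add E0r_scale theta_in_E0r)
qed

lemma bdd_above_Phi_r:
  assumes \<gamma>: "\<gamma> \<in> SN_tring s t" and a: "a \<in> E0r s t"
  shows "{x. \<gamma> x \<le> 1} \<noteq> {}" "bdd_above ((\<lambda>x. \<gamma> (a x)) ` {x. \<gamma> x \<le> 1})"
proof -
  have nn: "0 \<le> \<gamma> x" and tri: "\<gamma> (x + y) \<le> \<gamma> x + \<gamma> y" and hom: "\<gamma> (s c x) = cmod c * \<gamma> x"
    and prod: "\<gamma> (t x y z) \<le> \<gamma> x * \<gamma> y * \<gamma> z" for x y z c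
    using \<gamma> by (auto simp: SN_tring_def seminorm_on_def)
  have z: "\<gamma> 0 = 0" using hom[of 0 0] by simp
  then show "{x. \<gamma> x \<le> 1} \<noteq> {}" by (metis empty_iff mem_Collect_eq zero_le_one)
  have "\<exists>K\<ge>0. \<forall>x. \<gamma> (a x) \<le> K * \<gamma> x"
    using a
  proof (induction rule: E0r_induct)
    case zero
    then show ?case using z nn by (intro exI[of _ 0]) auto
  next
    case (step c y w a)
    then obtain K where K: "K \<ge> 0" "\<And>x. \<gamma> (a x) \<le> K * \<gamma> x" by auto
    have "\<gamma> ((fun_scale s c (theta t y w) + a) x) \<le> (cmod c * (\<gamma> y * \<gamma> w) + K) * \<gamma> x" for x
    proof -
      have "\<gamma> (s c (t x y w)) \<le> cmod c * (\<gamma> x * \<gamma> y * \<gamma> w)"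
        using prod by (simp add: hom mult_left_mono)
      then show ?thesis
        using tri[of "s c (t x y w)" "a x"] K(2)[of x]
        by (simp add: fun_scale_def theta_def algebra_simps)
    qed
    then show ?case using K(1) nn by (intro exI[of _ "cmod c * (\<gamma> y * \<gamma> w) + K"]) auto
  qed
  then obtain K where K: "K \<ge> 0" "\<And>x. \<gamma> (a x) \<le> K * \<gamma> x" by auto
  have "\<gamma> (a x) \<le> K" if "\<gamma> x \<le> 1" for x
    using K(2)[of x] mult_left_mono[OF that K(1)] by simp
  then show "bdd_above ((\<lambda>x. \<gamma> (a x)) ` {x. \<gamma> x \<le> 1})"
    by (auto intro!: bdd_aboveI2)
qed

end

context admissible_star_tring
begin

lemma ex1_star_r:
  "\<exists>!J. J \<in> extensional (E0r s t) \<and>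
    involution_on (fun_scale s) (E0r s t) mult_r J \<and>
    (\<forall>y z. J (theta t y z) = theta t z y)"
proof -
  define adj where "adj a b \<longleftrightarrow>
    (\<forall>u x v. t u (a x) v = t (b u) x v \<and> t u (b x) v = t (a u) x v)" for a b
  have adj_sym: "adj a b \<Longrightarrow> adj b a" for a b by (auto simp: adj_def)
  have adj_unique: "b = b'" if "adj a b" "adj a b'" for a b b'
  proof
    fix u
    have "t (b u - b' u) x v = 0" for x v
      using that add_fst[of "b u - b' u" "b' u" x v] by (simp add: adj_def)
    then have "b u - b' u = 0" by (rule admissible)
    then show "b u = b' u" by simp
  qed
  have adj_theta: "adj (theta t y z) (theta t z y)" for y z
    by (auto simp: adj_def theta_def assoc_left_mid)
  have adj_zero: "adj 0 0" by (auto simp: adj_def zero_fst zero_snd)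
  have adj_add: "adj (a + a') (b + b')" if "adj a b" "adj a' b'" for a b a' b'
    using that by (auto simp: adj_def add_fst additive_snd)
  have adj_scale: "adj (fun_scale s c a) (fun_scale s (cnj c) b)" if "adj a b" for a b c
    using that by (auto simp: adj_def fun_scale_def scale_fst conj_scale_snd)
  have adj_mult: "adj (mult_r a a') (mult_r b' b)" if "adj a b" "adj a' b'" for a b a' b'
    using that by (auto simp: adj_def mult_r_def)
  have ex: "\<exists>b\<in>E0r s t. adj a b" if "a \<in> E0r s t" for a
    using that
  proof (induction rule: E0r_induct)
    case zero
    then show ?case using adj_zero E0r_zero by blast
  next
    case (step c y z a)
    then show ?case by (meson adj_add adj_scale adj_theta E0r_add E0r_scale theta_in_E0r)
  qed
  define J where "J = (\<lambda>a\<in>E0r s t. THE b. adj a b)"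
  have J_eq: "J a = b" if "a \<in> E0r s t" "adj a b" for a b
    using that adj_unique by (auto simp: J_def)
  have J_adj: "adj a (J a)" and J_mem: "J a \<in> E0r s t" if "a \<in> E0r s t" for a
    using ex[OF that] J_eq[OF that] by auto
  have J_ext: "J \<in> extensional (E0r s t)" by (simp add: J_def)
  have J_inv: "involution_on (fun_scale s) (E0r s t) mult_r J"
    unfolding involution_on_def
  proof (intro conjI ballI allI)
    fix a b c
    assume a: "a \<in> E0r s t"
    show "J a \<in> E0r s t" by (rule J_mem[OF a])
    show "J (fun_scale s c a) = fun_scale s (cnj c) (J a)"
      by (rule J_eq[OF E0r_scale[OF a] adj_scale[OF J_adj[OF a]]])
    show "J (J a) = a"
      by (rule J_eq[OF J_mem[OF a] adj_sym[OF J_adj[OF a]]])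
    assume b: "b \<in> E0r s t"
    show "J (a + b) = J a + J b"
      by (rule J_eq[OF E0r_add[OF a b] adj_add[OF J_adj[OF a] J_adj[OF b]]])
    show "J (mult_r a b) = mult_r (J b) (J a)"
      by (rule J_eq[OF E0r_mult[OF a b] adj_mult[OF J_adj[OF a] J_adj[OF b]]])
  qed
  have J_theta: "J (theta t y z) = theta t z y" for y z
    by (rule J_eq[OF theta_in_E0r adj_theta])
  show ?thesis
  proof (rule ex1I[of _ J])
    show "J \<in> extensional (E0r s t) \<and> involution_on (fun_scale s) (E0r s t) mult_r J \<and>
        (\<forall>y z. J (theta t y z) = theta t z y)"
      using J_ext J_inv J_theta by blast
  next
    fix K
    assume K: "K \<in> extensional (E0r s t) \<and> involution_on (fun_scale s) (E0r s t) mult_r K \<and>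
        (\<forall>y z. K (theta t y z) = theta t z y)"
    then have K_add: "\<And>a b. a \<in> E0r s t \<Longrightarrow> b \<in> E0r s t \<Longrightarrow> K (a + b) = K a + K b"
      and K_scale: "\<And>c a. a \<in> E0r s t \<Longrightarrow> K (fun_scale s c a) = fun_scale s (cnj c) (K a)"
      by (auto simp: involution_on_def)
    have K_adj: "adj a (K a)" if "a \<in> E0r s t" for a
      using that
    proof (induction rule: E0r_induct)
      case zero
      have "K 0 = 0" using K_add[OF E0r_zero E0r_zero] by simp
      then show ?case using adj_zero by metis
    next
      case (step c y z a)
      have "K (fun_scale s c (theta t y z) + a) = fun_scale s (cnj c) (theta t z y) + K a"
        using K K_add[OF E0r_scale[OF theta_in_E0r] step(1)] K_scale[OF theta_in_E0r] by metis
      then show ?case using adj_add[OF adj_scale[OF adj_theta] step(2)] by metis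
    qed
    have "K a = J a" if "a \<in> E0r s t" for a
      using J_eq[OF that K_adj[OF that]] by (rule sym)
    moreover have "K a = J a" if "a \<notin> E0r s t" for a
      using that K by (auto simp: J_def extensional_def)
    ultimately show "K = J" by blast
  qed
qed

end

end

theory Submission
  imports Defs
begin

text \<open>The crucial point is that \<open>\<alpha> \<mapsto> \<alpha>~\<close> is an order embedding. If \<open>\<alpha>~ \<le> \<beta>~\<close>, the
  Cauchy--Schwarz inequality for \<open>\<alpha>\<close> gives \<open>\<alpha>(\<langle>x, y\<rangle>a) \<le> \<alpha>~(x) \<alpha>~(ya) \<le> \<beta>~(x) \<beta>~(y) \<beta>(a)\<close>,
  hence \<open>\<alpha>(ba) \<le> C\<^sub>b \<beta>(a)\<close> for all \<open>a\<close>. For a self-adjoint \<open>h\<close> the C*-identity yields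
  \<open>\<alpha>(h)\<^bsup>N\<^esup> = \<alpha>(h\<^bsup>N\<^esup>) \<le> C\<^sub>h \<beta>(h)\<^bsup>N - 1\<^esup>\<close> for \<open>N = 2\<^bsup>n\<^esup>\<close>, so \<open>\<alpha>(h) \<le> \<beta>(h)\<close>, and \<open>h = a\<^sup>*a\<close> gives
  \<open>\<alpha> \<le> \<beta>\<close>. Since the unit ball formula inverts \<open>\<alpha> \<mapsto> \<alpha>~\<close> on one side, both maps are
  isomorphisms of posets; the posets are lattices because a pointwise bounded supremum of
  C*-seminorms is a C*-seminorm.\<close>

section \<open>Lattices of functions\<close>

lemma pointwise_order_simps [simp]:
  "carrier (pointwise_order A F) = F"
  "le (pointwise_order A F) f g \<longleftrightarrow> (\<forall>a\<in>A. f a \<le> g a)"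
  "eq (pointwise_order A F) = (=)"
  by (simp_all add: pointwise_order_def)

text \<open>Antisymmetry is where extensionality enters: the order compares values on
  \<open>A\<close> only, and outside \<open>A\<close> all members of \<open>F\<close> agree.\<close>

lemma partial_order_pointwise_order:
  assumes "F \<subseteq> extensional A"
  shows "partial_order (pointwise_order A F)"
proof unfold_locales
  fix f g
  assume "f \<sqsubseteq>\<^bsub>pointwise_order A F\<^esub> g" "g \<sqsubseteq>\<^bsub>pointwise_order A F\<^esub> f"
    "f \<in> carrier (pointwise_order A F)" "g \<in> carrier (pointwise_order A F)"
  then have "f = g"
    using assms by (intro extensionalityI[of f A g]) (auto intro: antisym)
  then show "f .=\<^bsub>pointwise_order A F\<^esub> g" by simp
qed (auto intro: order_trans)

text \<open>Suprema of pointwise bounded families give everything. The join is the supremum of a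
  two-element family, that is, the pointwise maximum. The pointwise minimum need not lie in
  \<open>F\<close>, so the meet is the supremum of all common lower bounds; \<open>low\<close> makes
  that family nonempty, and \<open>f\<close> and \<open>g\<close> bound it.\<close>

lemma lattice_pointwise_order:
  assumes ext: "F \<subseteq> extensional A"
    and Sup: "\<And>S. S \<noteq> {} \<Longrightarrow> S \<subseteq> F \<Longrightarrow> (\<And>a. a \<in> A \<Longrightarrow> bdd_above ((\<lambda>f. f a) ` S)) \<Longrightarrow>
      (\<lambda>a\<in>A. SUP f\<in>S. f a) \<in> F"
    and low: "\<And>f g. f \<in> F \<Longrightarrow> g \<in> F \<Longrightarrow> \<exists>h\<in>F. \<forall>a\<in>A. h a \<le> f a \<and> h a \<le> g a"
  shows "lattice (pointwise_order A F)"
proof -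
  let ?L = "pointwise_order A F"
  interpret partial_order ?L by (rule partial_order_pointwise_order[OF ext])
  show ?thesis
  proof unfold_locales
    fix f g
    assume "f \<in> carrier ?L" "g \<in> carrier ?L"
    then have fg: "{f, g} \<subseteq> F" by simp
    let ?h = "\<lambda>a\<in>A. max (f a) (g a)"
    have "(\<lambda>a\<in>A. SUP k\<in>{f, g}. k a) \<in> F" using fg by (intro Sup) auto
    moreover have "(SUP k\<in>{f, g}. k a) = max (f a) (g a)" for a by (simp add: cSup_eq_Max)
    ultimately have h: "?h \<in> F" by simp
    have "least ?L ?h (Upper ?L {f, g})"
    proof (rule least_UpperI)
      show "k \<sqsubseteq>\<^bsub>?L\<^esub> ?h" if "k \<in> {f, g}" for k
        using that by auto
      show "?h \<sqsubseteq>\<^bsub>?L\<^esub> k" if "k \<in> Upper ?L {f, g}" for k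
        using that fg by (auto simp: Upper_def)
    qed (use fg h in auto)
    then show "\<exists>h. least ?L h (Upper ?L {f, g})" by blast
  next
    fix f g
    assume "f \<in> carrier ?L" "g \<in> carrier ?L"
    then have fg: "f \<in> F" "g \<in> F" by simp_all
    let ?S = "{k \<in> F. \<forall>a\<in>A. k a \<le> f a \<and> k a \<le> g a}"
    let ?h = "\<lambda>a\<in>A. SUP k\<in>?S. k a"
    have ne: "?S \<noteq> {}" using low[OF fg] by blast
    have bdd: "bdd_above ((\<lambda>k. k a) ` ?S)" if "a \<in> A" for a
      using that by (intro bdd_aboveI2[of _ _ "f a"]) auto
    have h: "?h \<in> F" using ne bdd by (intro Sup) auto
    have "greatest ?L ?h (Lower ?L {f, g})"
    proof (rule greatest_LowerI)
      show "?h \<sqsubseteq>\<^bsub>?L\<^esub> k" if "k \<in> {f, g}" for k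
        using that ne by (auto intro!: cSUP_least)
      show "k \<sqsubseteq>\<^bsub>?L\<^esub> ?h" if "k \<in> Lower ?L {f, g}" for k
        using that fg bdd by (auto simp: Lower_def intro!: cSUP_upper)
    qed (use fg h in auto)
    then show "\<exists>h. greatest ?L h (Lower ?L {f, g})" by blast
  qed
qed

text \<open>Only \<open>L\<close> is assumed to be a lattice. Bounds in \<open>M\<close> are
  obtained by moving to \<open>L\<close> along \<open>g\<close>, taking the join or meet there, and
  returning along \<open>f\<close>, so \<open>SN_cs\<close> needs no lattice construction of its
  own.\<close>

lemma lattice_iso_of_order_iso:
  assumes L: "lattice L" and M: "partial_order M"
    and f: "f \<in> carrier L \<rightarrow> carrier M" and g: "g \<in> carrier M \<rightarrow> carrier L"
    and gf: "\<And>x. x \<in> carrier L \<Longrightarrow> g (f x) = x"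
    and fg: "\<And>y. y \<in> carrier M \<Longrightarrow> f (g y) = y"
    and f_mono: "\<And>x x'. x \<in> carrier L \<Longrightarrow> x' \<in> carrier L \<Longrightarrow> x \<sqsubseteq>\<^bsub>L\<^esub> x' \<Longrightarrow> f x \<sqsubseteq>\<^bsub>M\<^esub> f x'"
    and g_mono: "\<And>y y'. y \<in> carrier M \<Longrightarrow> y' \<in> carrier M \<Longrightarrow> y \<sqsubseteq>\<^bsub>M\<^esub> y' \<Longrightarrow> g y \<sqsubseteq>\<^bsub>L\<^esub> g y'"
  shows "lattice_iso L M f" "lattice_iso M L g"
proof -
  interpret L: lattice L by (rule L)
  interpret M: partial_order M by (rule M)
  have fc: "f x \<in> carrier M" if "x \<in> carrier L" for x using f that by auto
  have gc: "g y \<in> carrier L" if "y \<in> carrier M" for y using g that by auto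
  have lub: "least M (f (g y \<squnion>\<^bsub>L\<^esub> g y')) (Upper M {y, y'})"
    if y: "y \<in> carrier M" "y' \<in> carrier M" for y y'
  proof (rule least_UpperI)
    show "z \<sqsubseteq>\<^bsub>M\<^esub> f (g y \<squnion>\<^bsub>L\<^esub> g y')" if "z \<in> {y, y'}" for z
      using that y L.join_left[of "g y" "g y'"] L.join_right[of "g y" "g y'"]
        f_mono[of "g z" "g y \<squnion>\<^bsub>L\<^esub> g y'"] fg gc by auto
    show "f (g y \<squnion>\<^bsub>L\<^esub> g y') \<sqsubseteq>\<^bsub>M\<^esub> z" if "z \<in> Upper M {y, y'}" for z
    proof -
      have z: "z \<in> carrier M" "y \<sqsubseteq>\<^bsub>M\<^esub> z" "y' \<sqsubseteq>\<^bsub>M\<^esub> z" using that y by (auto simp: Upper_def)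
      then have "g y \<squnion>\<^bsub>L\<^esub> g y' \<sqsubseteq>\<^bsub>L\<^esub> g z" using y gc g_mono by (intro L.join_le) auto
      then show ?thesis using f_mono[of "g y \<squnion>\<^bsub>L\<^esub> g y'" "g z"] y z gc fg by auto
    qed
  qed (use y fc gc in auto)
  have glb: "greatest M (f (g y \<sqinter>\<^bsub>L\<^esub> g y')) (Lower M {y, y'})"
    if y: "y \<in> carrier M" "y' \<in> carrier M" for y y'
  proof (rule greatest_LowerI)
    show "f (g y \<sqinter>\<^bsub>L\<^esub> g y') \<sqsubseteq>\<^bsub>M\<^esub> z" if "z \<in> {y, y'}" for z
      using that y L.meet_left[of "g y" "g y'"] L.meet_right[of "g y" "g y'"]
        f_mono[of "g y \<sqinter>\<^bsub>L\<^esub> g y'" "g z"] fg gc by auto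
    show "z \<sqsubseteq>\<^bsub>M\<^esub> f (g y \<sqinter>\<^bsub>L\<^esub> g y')" if "z \<in> Lower M {y, y'}" for z
    proof -
      have z: "z \<in> carrier M" "z \<sqsubseteq>\<^bsub>M\<^esub> y" "z \<sqsubseteq>\<^bsub>M\<^esub> y'" using that y by (auto simp: Lower_def)
      then have "g z \<sqsubseteq>\<^bsub>L\<^esub> g y \<sqinter>\<^bsub>L\<^esub> g y'" using y gc g_mono by (intro L.meet_le) auto
      then show ?thesis using f_mono[of "g z" "g y \<sqinter>\<^bsub>L\<^esub> g y'"] y z gc fg by auto
    qed
  qed (use y fc gc in auto)
  interpret M': lattice M
  proof unfold_locales
    fix y y' assume y: "y \<in> carrier M" "y' \<in> carrier M"
    show "\<exists>z. least M z (Upper M {y, y'})" by (rule exI[of _ "f (g y \<squnion>\<^bsub>L\<^esub> g y')"], rule lub[OF y])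
    show "\<exists>z. greatest M z (Lower M {y, y'})" by (rule exI[of _ "f (g y \<sqinter>\<^bsub>L\<^esub> g y')"], rule glb[OF y])
  qed
  have join: "y \<squnion>\<^bsub>M\<^esub> y' = f (g y \<squnion>\<^bsub>L\<^esub> g y')" if "y \<in> carrier M" "y' \<in> carrier M" for y y'
    by (rule M'.joinI[OF _ that]) (rule M.least_unique[OF _ lub[OF that]])
  have meet: "y \<sqinter>\<^bsub>M\<^esub> y' = f (g y \<sqinter>\<^bsub>L\<^esub> g y')" if "y \<in> carrier M" "y' \<in> carrier M" for y y'
    by (rule M'.meetI[OF _ that]) (rule M.greatest_unique[OF _ glb[OF that]])
  have "bij_betw f (carrier L) (carrier M)" "bij_betw g (carrier M) (carrier L)"
    using fc gc gf fg
    by (auto intro!: bij_betw_byWitness[of _ g f] bij_betw_byWitness[of _ f g])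
  then show "lattice_iso L M f" "lattice_iso M L g"
    using L M'.lattice_axioms join meet fc gc gf fg
    by (auto simp: lattice_iso_def join_pres_def meet_pres_def)
qed


section \<open>C*-seminorms on the ternary ring\<close>

lemma SN_tringD:
  assumes "\<gamma> \<in> SN_tring s t"
  shows "0 \<le> \<gamma> x" "\<gamma> (x + y) \<le> \<gamma> x + \<gamma> y" "\<gamma> (s c x) = cmod c * \<gamma> x"
    "\<gamma> (t x y z) \<le> \<gamma> x * \<gamma> y * \<gamma> z" "\<gamma> (t x x x) = \<gamma> x ^ 3"
  using assms by (auto simp: SN_tring_def seminorm_on_def)

text \<open>All conditions survive a pointwise supremum. Inequalities pass over by bounding each
  member; each equation needs a reverse estimate, found by first solving for \<gamma> x and only
  then taking the supremum.\<close>

lemma SN_tring_Sup: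
  assumes ne: "S \<noteq> {}" and S: "S \<subseteq> SN_tring s t"
    and bdd: "\<And>x. bdd_above ((\<lambda>\<gamma>. \<gamma> x) ` S)"
  shows "(\<lambda>x. SUP \<gamma>\<in>S. \<gamma> x) \<in> SN_tring s t"
proof -
  define p where "p x = (SUP \<gamma>\<in>S. \<gamma> x)" for x
  have upper: "\<gamma> x \<le> p x" if "\<gamma> \<in> S" for \<gamma> x
    unfolding p_def using that bdd by (rule cSUP_upper)
  have least: "p x \<le> K" if "\<And>\<gamma>. \<gamma> \<in> S \<Longrightarrow> \<gamma> x \<le> K" for x K
    unfolding p_def using ne that by (rule cSUP_least)
  note D = SN_tringD[OF subsetD[OF S]]
  have nn: "0 \<le> p x" for x
  proof -
    obtain \<gamma> where "\<gamma> \<in> S" using ne by blast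
    then show ?thesis using D(1) upper order_trans by blast
  qed
  have "p (x + y) \<le> p x + p y" for x y
    by (rule least) (meson D(2) add_mono order_trans upper)
  moreover have "p (s c x) = cmod c * p x" for c x
  proof (rule antisym)
    show "p (s c x) \<le> cmod c * p x"
      by (rule least) (simp add: D(3) upper mult_left_mono)
    show "cmod c * p x \<le> p (s c x)"
    proof (cases "c = 0")
      case False
      have "p x \<le> p (s c x) / cmod c"
        using False upper[of _ "s c x"] by (intro least) (simp add: D(3) field_simps)
      then show ?thesis using False by (simp add: field_simps)
    qed (use nn in simp)
  qed
  moreover have "p (t x y z) \<le> p x * p y * p z" for x y z
  proof (rule least)
    fix \<gamma> assume \<gamma>: "\<gamma> \<in> S"
    have "\<gamma> x * \<gamma> y * \<gamma> z \<le> p x * p y * p z"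
      using upper[OF \<gamma>] D(1)[OF \<gamma>] nn by (intro mult_mono) simp_all
    then show "\<gamma> (t x y z) \<le> p x * p y * p z" using D(4)[OF \<gamma>, of x y z] by linarith
  qed
  moreover have "p (t x x x) = p x ^ 3" for x
  proof (rule antisym)
    show "p (t x x x) \<le> p x ^ 3"
      by (rule least) (metis D(1,5) power_mono upper)
    \<comment> \<open>Taking cube roots puts the supremum \<open>p x\<close> alone on the left,
      where \<open>least\<close> applies.\<close>
    have "p x \<le> root 3 (p (t x x x))"
    proof (rule least)
      fix \<gamma> assume \<gamma>: "\<gamma> \<in> S"
      have "root 3 (\<gamma> x ^ 3) \<le> root 3 (p (t x x x))"
        using upper[OF \<gamma>, of "t x x x"] D(5)[OF \<gamma>] by simp
      then show "\<gamma> x \<le> root 3 (p (t x x x))"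
        using D(1)[OF \<gamma>] by (simp add: real_root_power_cancel)
    qed
    then have "p x ^ 3 \<le> root 3 (p (t x x x)) ^ 3" using nn by (rule power_mono)
    then show "p x ^ 3 \<le> p (t x x x)" using nn by simp
  qed
  ultimately have "p \<in> SN_tring s t" using nn by (auto simp: SN_tring_def seminorm_on_def)
  then show ?thesis by (simp add: p_def[abs_def])
qed

text \<open>The zero seminorm lies below every pair, so meets exist.\<close>

lemma lattice_SN_tring: "lattice (pointwise_order UNIV (SN_tring s t))"
proof (rule lattice_pointwise_order)
  have "(\<lambda>x. 0) \<in> SN_tring s t" by (simp add: SN_tring_def seminorm_on_def)
  then show "\<exists>h\<in>SN_tring s t. \<forall>a\<in>UNIV. h a \<le> f a \<and> h a \<le> g a"
    if "f \<in> SN_tring s t" "g \<in> SN_tring s t" for f g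
    using that SN_tringD(1) by (intro bexI[of _ "\<lambda>x. 0"]) auto
qed (simp_all add: extensional_def restrict_def SN_tring_Sup)


section \<open>C*-seminorms on the algebra of operators\<close>

lemma SN_csD:
  assumes "\<alpha> \<in> SN_cs s t"
  shows "\<alpha> \<in> extensional (E0r s t)"
    "a \<in> E0r s t \<Longrightarrow> 0 \<le> \<alpha> a"
    "a \<in> E0r s t \<Longrightarrow> b \<in> E0r s t \<Longrightarrow> \<alpha> (a + b) \<le> \<alpha> a + \<alpha> b"
    "a \<in> E0r s t \<Longrightarrow> \<alpha> (fun_scale s c a) = cmod c * \<alpha> a"
    "a \<in> E0r s t \<Longrightarrow> b \<in> E0r s t \<Longrightarrow> \<alpha> (mult_r a b) \<le> \<alpha> a * \<alpha> b"
    "a \<in> E0r s t \<Longrightarrow> \<alpha> (mult_r (star_r s t a) a) = (\<alpha> a)\<^sup>2"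
    "(\<alpha> (theta t x y))\<^sup>2 \<le> \<alpha> (theta t x x) * \<alpha> (theta t y y)"
  using assms by (auto simp: SN_cs_def SN_alg_def seminorm_on_def)

text \<open>If 0 < y < x, the hypothesis bounds (x / y)^N by C / y along N = 2^n, although these
  powers are unbounded. Exponents are restricted to powers of two because the C*-identity controls
  exactly those; n = 0 is left out because the factor on the right would then come from the zeroth
  power of an operator.\<close>

lemma le_of_power_le:
  fixes x y C :: real
  assumes x: "0 \<le> x" and y: "0 \<le> y"
    and le: "\<And>n. 0 < n \<Longrightarrow> x ^ 2 ^ n \<le> C * y ^ (2 ^ n - 1)"
  shows "x \<le> y"
proof (rule ccontr)
  assume "\<not> x \<le> y"
  then have xy: "y < x" by simp
  show False
  proof (cases "y = 0")
    case True
    then show False using le[of 1] xy by simp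
  next
    case False
    then have y: "0 < y" using y by simp
    obtain n where n: "C / y < (x / y) ^ n"
      using real_arch_pow[of "x / y" "C / y"] xy y by auto
    let ?N = "2 ^ Suc n :: nat"
    have "n \<le> ?N" using less_exp[of "Suc n"] by linarith
    then have "(x / y) ^ n \<le> (x / y) ^ ?N" using xy y by (intro power_increasing) auto
    with n have "C / y < (x / y) ^ ?N" by linarith
    also have "\<dots> = x ^ ?N / (y * y ^ (?N - 1))"
      by (simp only: power_divide) (simp flip: power_Suc)
    also have "\<dots> \<le> C * y ^ (?N - 1) / (y * y ^ (?N - 1))"
      using le[of "Suc n"] y by (intro divide_right_mono) auto
    also have "\<dots> = C / y" using y by simp
    finally show False by simp
  qed
qed

context star_tring
begin

text \<open>This is \<open>assoc_left_right\<close> for the generators \<open>theta t u v\<close>,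
  extended linearly to their span.\<close>

lemma E0r_act_trd:
  assumes "a \<in> E0r s t"
  shows "a (t x y z) = t x y (a z)"
  using assms
  by (induction rule: E0r_induct)
    (auto simp: zero_trd add_trd scale_trd fun_scale_def theta_def assoc_left_right)

end

context admissible_star_tring
begin

section \<open>The involution as adjoint of the right action\<close>

lemma star_r_spec:
  "involution_on (fun_scale s) (E0r s t) mult_r (star_r s t)"
  "star_r s t (theta t y z) = theta t z y"
  using theI'[OF ex1_star_r] unfolding star_r_def[symmetric] by auto

lemma star_r_in_E0r: "a \<in> E0r s t \<Longrightarrow> star_r s t a \<in> E0r s t"
  and star_r_add: "a \<in> E0r s t \<Longrightarrow> b \<in> E0r s t \<Longrightarrow> star_r s t (a + b) = star_r s t a + star_r s t b"
  and star_r_scale: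
    "a \<in> E0r s t \<Longrightarrow> star_r s t (fun_scale s c a) = fun_scale s (cnj c) (star_r s t a)"
  and star_r_star_r: "a \<in> E0r s t \<Longrightarrow> star_r s t (star_r s t a) = a"
  and star_r_mult: "a \<in> E0r s t \<Longrightarrow> b \<in> E0r s t \<Longrightarrow>
    star_r s t (mult_r a b) = mult_r (star_r s t b) (star_r s t a)"
  using star_r_spec(1) by (auto simp: involution_on_def)

text \<open>On generators this is \<open>assoc_left_mid\<close>. It extends to the span because the
  triple product is conjugate linear in its second variable, just as the involution is conjugate
  linear.\<close>

lemma star_r_adjoint:
  assumes "a \<in> E0r s t"
  shows "t u (a x) v = t (star_r s t a u) x v"
  using assms
proof (induction rule: E0r_induct)
  case zero
  have star_zero: "star_r s t 0 = 0" using star_r_add[OF E0r_zero E0r_zero] by simp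
  show ?case unfolding star_zero by (simp add: zero_fst zero_snd)
next
  case (step c y z a)
  have star: "star_r s t (fun_scale s c (theta t y z) + a)
      = fun_scale s (cnj c) (theta t z y) + star_r s t a"
    using step(1) by (simp add: star_r_add star_r_scale E0r_scale theta_in_E0r star_r_spec(2))
  show ?case
    unfolding star using step(2) by (simp add: fun_scale_def theta_def additive_snd add_fst conj_scale_snd
        scale_fst assoc_left_mid)
qed

lemma theta_act_right:
  assumes "a \<in> E0r s t"
  shows "theta t x (a y) = mult_r (theta t x y) a"
  by (rule ext) (simp add: theta_def mult_r_def E0r_act_trd[OF assms])

text \<open>The sesquilinearity rule \<langle>xa, ya\<rangle> = a^* \<langle>x, y\<rangle> a of a
  Hilbert module: the adjoint relation moves \<open>a\<close> out of the second slot, and linearity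
  over the algebra moves it out of the third.\<close>

lemma theta_act:
  assumes "a \<in> E0r s t"
  shows "theta t (a x) (a y) = mult_r (star_r s t a) (mult_r (theta t x y) a)"
  by (rule ext) (simp add: theta_def mult_r_def E0r_act_trd[OF assms] star_r_adjoint[OF assms])

section \<open>Cauchy-Schwarz and module bounds for \<open>Psi_r\<close>\<close>

lemma Psi_r_nonneg:
  assumes "\<alpha> \<in> SN_cs s t"
  shows "0 \<le> Psi_r t \<alpha> x"
  using SN_csD(2)[OF assms theta_in_E0r] by (simp add: Psi_r_def)

lemma Psi_r_square:
  assumes "\<alpha> \<in> SN_cs s t"
  shows "(Psi_r t \<alpha> x)\<^sup>2 = \<alpha> (theta t x x)"
  using SN_csD(2)[OF assms theta_in_E0r] by (simp add: Psi_r_def)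

lemma SN_cs_Cauchy_Schwarz:
  assumes "\<alpha> \<in> SN_cs s t"
  shows "\<alpha> (theta t x y) \<le> Psi_r t \<alpha> x * Psi_r t \<alpha> y"
proof (rule power2_le_imp_le)
  show "(\<alpha> (theta t x y))\<^sup>2 \<le> (Psi_r t \<alpha> x * Psi_r t \<alpha> y)\<^sup>2"
    using SN_csD(7)[OF assms] by (simp only: power_mult_distrib Psi_r_square[OF assms])
  show "0 \<le> Psi_r t \<alpha> x * Psi_r t \<alpha> y"
    by (intro mult_nonneg_nonneg Psi_r_nonneg[OF assms])
qed

lemma SN_cs_star:
  assumes "\<alpha> \<in> SN_cs s t" "a \<in> E0r s t"
  shows "\<alpha> (star_r s t a) = \<alpha> a"
proof -
  have le: "\<alpha> b \<le> \<alpha> (star_r s t b)" if b: "b \<in> E0r s t" for b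
  proof (cases "\<alpha> b = 0")
    case False
    then have "0 < \<alpha> b" using SN_csD(2)[OF assms(1) b] by simp
    moreover have "\<alpha> b * \<alpha> b \<le> \<alpha> (star_r s t b) * \<alpha> b"
      using SN_csD(5)[OF assms(1) star_r_in_E0r[OF b] b] SN_csD(6)[OF assms(1) b]
      by (simp add: power2_eq_square)
    ultimately show ?thesis by simp
  qed (use SN_csD(2)[OF assms(1) star_r_in_E0r[OF b]] in simp)
  show ?thesis
    using le[OF assms(2)] le[OF star_r_in_E0r[OF assms(2)]] star_r_star_r[OF assms(2)] by simp
qed

lemma Psi_r_act:
  assumes "\<alpha> \<in> SN_cs s t" "a \<in> E0r s t"
  shows "Psi_r t \<alpha> (a x) \<le> \<alpha> a * Psi_r t \<alpha> x"
proof (rule power2_le_imp_le)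
  note D = SN_csD[OF assms(1)]
  note mem = assms(2) star_r_in_E0r[OF assms(2)] theta_in_E0r E0r_mult[OF theta_in_E0r assms(2)]
  have "(Psi_r t \<alpha> (a x))\<^sup>2 = \<alpha> (mult_r (star_r s t a) (mult_r (theta t x x) a))"
    by (simp add: Psi_r_square assms theta_act)
  also have "\<dots> \<le> \<alpha> a * (\<alpha> (theta t x x) * \<alpha> a)"
    using D(5)[OF mem(2,4), of x x] D(5)[OF mem(3,1), of x x] D(2)[OF mem(1)]
    by (auto simp: SN_cs_star assms intro: order_trans mult_left_mono)
  also have "\<dots> = (\<alpha> a * Psi_r t \<alpha> x)\<^sup>2"
    by (simp add: power_mult_distrib Psi_r_square assms) (simp add: power2_eq_square)
  finally show "(Psi_r t \<alpha> (a x))\<^sup>2 \<le> (\<alpha> a * Psi_r t \<alpha> x)\<^sup>2" .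
  show "0 \<le> \<alpha> a * Psi_r t \<alpha> x"
    using D(2)[OF assms(2)] Psi_r_nonneg[OF assms(1)] by simp
qed

section \<open>Powers of operators and the C*-identity\<close>

lemma funpow_in_E0r: "a \<in> E0r s t \<Longrightarrow> a ^^ Suc n \<in> E0r s t"
proof (induction n)
  case (Suc n)
  have "a ^^ Suc (Suc n) = mult_r (a ^^ Suc n) a" by (simp add: mult_r_def)
  then show ?case using Suc E0r_mult by metis
qed simp

lemma SN_cs_funpow_le:
  assumes "\<alpha> \<in> SN_cs s t" "a \<in> E0r s t"
  shows "\<alpha> (a ^^ Suc n) \<le> \<alpha> a ^ Suc n"
proof (induction n)
  case (Suc n)
  have "\<alpha> (a ^^ Suc (Suc n)) = \<alpha> (mult_r (a ^^ Suc n) a)" by (simp add: mult_r_def)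
  also have "\<dots> \<le> \<alpha> (a ^^ Suc n) * \<alpha> a"
    by (rule SN_csD(5)[OF assms(1) funpow_in_E0r assms(2)]) (rule assms(2))
  also have "\<dots> \<le> \<alpha> a ^ Suc n * \<alpha> a"
    by (rule mult_right_mono[OF Suc.IH SN_csD(2)[OF assms]])
  finally show ?case by (simp only: power_Suc2)
qed simp

lemma SN_cs_self_adjoint_funpow:
  assumes \<alpha>: "\<alpha> \<in> SN_cs s t" and h: "h \<in> E0r s t" and self: "star_r s t h = h"
  shows "\<alpha> (h ^^ 2 ^ n) = \<alpha> h ^ 2 ^ n"
proof -
  \<comment> \<open>Membership and self-adjointness join the induction because the C*-identity reads
    \<alpha>(kk) = \<alpha>(k)^2 only for a self-adjoint k in the algebra.\<close>
  have "h ^^ 2 ^ n \<in> E0r s t \<and> star_r s t (h ^^ 2 ^ n) = h ^^ 2 ^ n \<and> \<alpha> (h ^^ 2 ^ n) = \<alpha> h ^ 2 ^ n"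
  proof (induction n)
    case 0
    show ?case using h self by simp
  next
    case (Suc n)
    let ?k = "h ^^ 2 ^ n"
    have eq: "h ^^ 2 ^ Suc n = mult_r ?k ?k"
      by (simp add: mult_r_def mult_2 funpow_add)
    have "\<alpha> (mult_r ?k ?k) = (\<alpha> ?k)\<^sup>2" using SN_csD(6)[OF \<alpha>, of ?k] Suc by simp
    moreover have "star_r s t (mult_r ?k ?k) = mult_r ?k ?k"
      using Suc by (simp add: star_r_mult)
    moreover have "mult_r ?k ?k \<in> E0r s t" using Suc by (intro E0r_mult) auto
    ultimately show ?case
      unfolding eq using Suc by (simp add: power_mult[symmetric] mult.commute)
  qed
  then show ?thesis by simp
qed

text \<open>Three is not a power of two, so the lower bound comes from the fourth power:
  \<alpha>(h)^4 = \<alpha>(h^4) \<le> \<alpha>(h^3) \<alpha>(h). This supplies the cube identity for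
  \<open>Psi_r\<close>.\<close>

lemma SN_cs_self_adjoint_cube:
  assumes \<alpha>: "\<alpha> \<in> SN_cs s t" and h: "h \<in> E0r s t" and self: "star_r s t h = h"
  shows "\<alpha> (h ^^ 3) = \<alpha> h ^ 3"
proof (rule antisym)
  show "\<alpha> (h ^^ 3) \<le> \<alpha> h ^ 3"
    using SN_cs_funpow_le[OF \<alpha> h, of 2] by (simp only: numeral_3_eq_3 numeral_2_eq_2)
  show "\<alpha> h ^ 3 \<le> \<alpha> (h ^^ 3)"
  proof (cases "\<alpha> h = 0")
    case True
    have "h ^^ 3 \<in> E0r s t" using funpow_in_E0r[OF h, of 2] by (simp only: numeral_3_eq_3 numeral_2_eq_2)
    then show ?thesis using SN_csD(2)[OF \<alpha>] True by simp
  next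
    case False
    then have pos: "0 < \<alpha> h" using SN_csD(2)[OF \<alpha> h] by simp
    have "h ^^ 3 \<in> E0r s t" using funpow_in_E0r[OF h, of 2] by (simp only: numeral_3_eq_3 numeral_2_eq_2)
    then have "\<alpha> (mult_r (h ^^ 3) h) \<le> \<alpha> (h ^^ 3) * \<alpha> h" using h by (rule SN_csD(5)[OF \<alpha>])
    moreover have "mult_r (h ^^ 3) h = h ^^ 2 ^ 2"
      by (simp add: mult_r_def numeral_3_eq_3 numeral_eq_Suc)
    ultimately have "\<alpha> h ^ 3 * \<alpha> h \<le> \<alpha> (h ^^ 3) * \<alpha> h"
      using SN_cs_self_adjoint_funpow[OF assms, of 2] by (simp add: power_numeral_reduce)
    then show ?thesis using pos by simp
  qed
qed

text \<open>For a generator, \<langle>y, z\<rangle>a = \<langle>y, za\<rangle> is estimated by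
  Cauchy-Schwarz for \<alpha>, then the comparison hypothesis, then the module bound for \<beta>.
  Constants add up along a linear combination; \<open>C\<close> depends on \<open>b\<close> but not
  on \<open>a\<close>.\<close>

lemma SN_cs_mult_bound:
  assumes \<alpha>: "\<alpha> \<in> SN_cs s t" and \<beta>: "\<beta> \<in> SN_cs s t"
    and le: "\<And>x. Psi_r t \<alpha> x \<le> Psi_r t \<beta> x" and b: "b \<in> E0r s t"
  shows "\<exists>C\<ge>0. \<forall>a\<in>E0r s t. \<alpha> (mult_r b a) \<le> C * \<beta> a"
  using b
proof (induction rule: E0r_induct)
  case zero
  have "\<alpha> 0 = 0" using SN_csD(4)[OF \<alpha> E0r_zero, of 0] by (simp add: fun_scale_def zero_fun_def)
  moreover have "mult_r 0 a = 0" if "a \<in> E0r s t" for a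
    using E0r_linear(2)[OF that, of 0] by (auto simp: mult_r_def fun_eq_iff)
  ultimately have "\<forall>a\<in>E0r s t. \<alpha> (mult_r 0 a) \<le> 0 * \<beta> a" by (metis mult_zero_left order_refl)
  then show ?case by blast
next
  case (step c y z b)
  then obtain C where C: "C \<ge> 0" "\<And>a. a \<in> E0r s t \<Longrightarrow> \<alpha> (mult_r b a) \<le> C * \<beta> a" by auto
  have "\<alpha> (mult_r (fun_scale s c (theta t y z) + b) a)
      \<le> (cmod c * (Psi_r t \<beta> y * Psi_r t \<beta> z) + C) * \<beta> a" if a: "a \<in> E0r s t" for a
  proof -
    have "mult_r (fun_scale s c (theta t y z) + b) a
        = fun_scale s c (theta t y (a z)) + mult_r b a"
      by (auto simp: mult_r_def fun_eq_iff E0r_linear[OF a] fun_scale_def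
          fun_cong[OF theta_act_right[OF a]])
    then have "\<alpha> (mult_r (fun_scale s c (theta t y z) + b) a)
        \<le> cmod c * \<alpha> (theta t y (a z)) + \<alpha> (mult_r b a)" (is "?l \<le> _")
      using SN_csD(3)[OF \<alpha> E0r_scale[OF theta_in_E0r] E0r_mult[OF step(1) a]]
        SN_csD(4)[OF \<alpha> theta_in_E0r] by metis
    moreover have "\<alpha> (theta t y (a z)) \<le> Psi_r t \<beta> y * (\<beta> a * Psi_r t \<beta> z)"
    proof -
      have "\<alpha> (theta t y (a z)) \<le> Psi_r t \<alpha> y * Psi_r t \<alpha> (a z)"
        by (rule SN_cs_Cauchy_Schwarz[OF \<alpha>])
      also have "\<dots> \<le> Psi_r t \<beta> y * (\<beta> a * Psi_r t \<beta> z)"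
        using le Psi_r_nonneg[OF \<alpha>] Psi_r_nonneg[OF \<beta>] order_trans[OF le Psi_r_act[OF \<beta> a]]
        by (intro mult_mono) simp_all
      finally show ?thesis .
    qed
    then have "cmod c * \<alpha> (theta t y (a z)) \<le> cmod c * (Psi_r t \<beta> y * (\<beta> a * Psi_r t \<beta> z))"
      by (rule mult_left_mono) simp
    ultimately have "?l \<le> cmod c * (Psi_r t \<beta> y * (\<beta> a * Psi_r t \<beta> z)) + C * \<beta> a"
      using C(2)[OF a] by linarith
    then show ?thesis by (simp only: distrib_right mult.assoc mult.commute[of "Psi_r t \<beta> z"])
  qed
  moreover have "0 \<le> cmod c * (Psi_r t \<beta> y * Psi_r t \<beta> z) + C"
    using C(1) Psi_r_nonneg[OF \<beta>] by simp
  ultimately show ?case by blast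
qed

lemma SN_cs_le_of_Psi_r_le:
  assumes \<alpha>: "\<alpha> \<in> SN_cs s t" and \<beta>: "\<beta> \<in> SN_cs s t"
    and le: "\<And>x. Psi_r t \<alpha> x \<le> Psi_r t \<beta> x" and a: "a \<in> E0r s t"
  shows "\<alpha> a \<le> \<beta> a"
proof -
  let ?h = "mult_r (star_r s t a) a"
  have h: "?h \<in> E0r s t" using a by (intro E0r_mult star_r_in_E0r)
  have self: "star_r s t ?h = ?h"
    using a by (simp add: star_r_mult star_r_in_E0r star_r_star_r)
  obtain C where C: "C \<ge> 0" "\<And>b. b \<in> E0r s t \<Longrightarrow> \<alpha> (mult_r ?h b) \<le> C * \<beta> b"
    using SN_cs_mult_bound[OF \<alpha> \<beta> le h] by auto
  have "\<alpha> ?h \<le> \<beta> ?h"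
  proof (rule le_of_power_le)
    show "0 \<le> \<alpha> ?h" "0 \<le> \<beta> ?h" using SN_csD(2)[OF \<alpha> h] SN_csD(2)[OF \<beta> h] .
    fix n :: nat assume "0 < n"
    then have "2 ^ 1 \<le> (2 ^ n :: nat)" by (intro power_increasing) auto
    \<comment> \<open>One factor of \<open>?h\<close> is spent on the constant \<open>C\<close>. At
      least one must remain, since the zeroth power is the identity map, which need not lie in
      \<open>E0r s t\<close>.\<close>
    then obtain k where k: "2 ^ n = Suc (Suc k)"
      by (metis One_nat_def Suc_le_D Suc_le_mono numeral_2_eq_2 power_one_right)
    have "\<alpha> ?h ^ 2 ^ n = \<alpha> (?h ^^ Suc (Suc k))"
      using SN_cs_self_adjoint_funpow[OF \<alpha> h self, of n] unfolding k by (rule sym)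
    also have "\<dots> = \<alpha> (mult_r ?h (?h ^^ Suc k))"
      by (simp only: mult_r_def funpow_Suc_right)
    also have "\<dots> \<le> C * \<beta> (?h ^^ Suc k)" by (rule C(2)[OF funpow_in_E0r[OF h]])
    also have "\<dots> \<le> C * \<beta> ?h ^ Suc k"
      by (rule mult_left_mono[OF SN_cs_funpow_le[OF \<beta> h] C(1)])
    finally show "\<alpha> ?h ^ 2 ^ n \<le> C * \<beta> ?h ^ (2 ^ n - 1)" using k by simp
  qed
  then have "(\<alpha> a)\<^sup>2 \<le> (\<beta> a)\<^sup>2" using SN_csD(6)[OF \<alpha> a] SN_csD(6)[OF \<beta> a] by simp
  then show ?thesis using SN_csD(2)[OF \<beta> a] by (rule power2_le_imp_le)
qed


section \<open>The two maps\<close>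

text \<open>Cauchy-Schwarz yields the triangle inequality as for an inner product, the module bound
  yields submultiplicativity, and the cube identity reduces to the one for the self-adjoint element
  \<langle>x, x\<rangle>.\<close>

lemma Psi_r_in_SN_tring:
  assumes \<alpha>: "\<alpha> \<in> SN_cs s t"
  shows "Psi_r t \<alpha> \<in> SN_tring s t"
proof -
  let ?p = "Psi_r t \<alpha>"
  note D = SN_csD[OF \<alpha>] and nn = Psi_r_nonneg[OF \<alpha>] and sq = Psi_r_square[OF \<alpha>]
    and CS = SN_cs_Cauchy_Schwarz[OF \<alpha>]
  have tri: "?p (x + y) \<le> ?p x + ?p y" for x y
  proof (rule power2_le_imp_le)
    have "theta t (x + y) (x + y) = (theta t x x + theta t x y) + (theta t y x + theta t y y)"
      by (simp add: fun_eq_iff theta_def additive_snd add_trd)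
    then have "(?p (x + y))\<^sup>2 \<le> (\<alpha> (theta t x x) + \<alpha> (theta t x y))
        + (\<alpha> (theta t y x) + \<alpha> (theta t y y))"
      unfolding sq
      using D(3)[OF E0r_add[OF theta_in_E0r theta_in_E0r] E0r_add[OF theta_in_E0r theta_in_E0r],
          of x x x y y x y y]
        D(3)[OF theta_in_E0r theta_in_E0r, of x x x y] D(3)[OF theta_in_E0r theta_in_E0r, of y x y y]
      by simp
    also have "\<dots> \<le> ((?p x)\<^sup>2 + ?p x * ?p y) + (?p y * ?p x + (?p y)\<^sup>2)"
      unfolding sq using CS[of x y] CS[of y x] by linarith
    also have "\<dots> = (?p x + ?p y)\<^sup>2" by (simp add: power2_eq_square algebra_simps)
    finally show "(?p (x + y))\<^sup>2 \<le> (?p x + ?p y)\<^sup>2" .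
  qed (use nn in simp)
  have hom: "?p (s c x) = cmod c * ?p x" for c x
  proof -
    have "theta t (s c x) (s c x) = fun_scale s (cnj c) (fun_scale s c (theta t x x))"
      by (simp add: fun_eq_iff theta_def fun_scale_def conj_scale_snd scale_trd)
    then have "\<alpha> (theta t (s c x) (s c x)) = cmod c * (cmod c * \<alpha> (theta t x x))"
      using D(4) E0r_scale theta_in_E0r by (simp add: norm_mult)
    then show ?thesis by (simp add: Psi_r_def real_sqrt_mult flip: mult.assoc)
  qed
  have prod: "?p (t x y z) \<le> ?p x * ?p y * ?p z" for x y z
  proof -
    have "?p (t x y z) \<le> \<alpha> (theta t y z) * ?p x"
      using Psi_r_act[OF \<alpha> theta_in_E0r[of y z], of x] by (simp add: theta_def)
    also have "\<dots> \<le> (?p y * ?p z) * ?p x" using CS nn by (rule mult_right_mono)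
    finally show ?thesis by (simp add: mult_ac)
  qed
  have cube: "?p (t x x x) = ?p x ^ 3" for x
  proof -
    let ?h = "theta t x x"
    \<comment> \<open>Here (x, x, x) = xh with h = \<langle>x, x\<rangle> self-adjoint, so its inner
      square is h^* h h.\<close>
    have "theta t (?h x) (?h x) = ?h ^^ 3"
      by (simp add: theta_act theta_in_E0r star_r_spec(2) mult_r_def numeral_3_eq_3 comp_assoc)
    then have "\<alpha> (theta t (t x x x) (t x x x)) = \<alpha> ?h ^ 3"
      using SN_cs_self_adjoint_cube[OF \<alpha> theta_in_E0r star_r_spec(2), of x] by (simp add: theta_def)
    then show ?thesis by (simp add: Psi_r_def real_sqrt_power)
  qed
  show ?thesis
    using nn tri hom prod cube by (auto simp: SN_tring_def seminorm_on_def)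
qed

text \<open>Rescale \<open>x\<close> into the unit ball. If \<gamma> x = 0, every multiple of
  \<open>x\<close> is in the ball, so finiteness of the supremum forces \<gamma> (a x) = 0.\<close>

lemma Phi_r_act:
  assumes \<gamma>: "\<gamma> \<in> SN_tring s t" and a: "a \<in> E0r s t"
  shows "\<gamma> (a x) \<le> Phi_r s t \<gamma> a * \<gamma> x"
proof -
  note D = SN_tringD[OF \<gamma>]
  have ball: "\<gamma> (a u) \<le> Phi_r s t \<gamma> a" if "\<gamma> u \<le> 1" for u
    using cSUP_upper[OF _ bdd_above_Phi_r(2)[OF \<gamma> a], of u] that a by (simp add: Phi_r_def)
  have scaled: "r * \<gamma> (a x) \<le> Phi_r s t \<gamma> a" if "0 \<le> r" "r * \<gamma> x \<le> 1" for r
    using ball[of "s (complex_of_real r) x"] that by (simp add: D(3) E0r_linear[OF a])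
  show ?thesis
  proof (cases "\<gamma> x = 0")
    case True
    have "\<gamma> (a x) \<le> 0"
    proof (rule ccontr)
      assume "\<not> \<gamma> (a x) \<le> 0"
      then have pos: "0 < \<gamma> (a x)" by simp
      obtain n :: nat where "Phi_r s t \<gamma> a < real n * \<gamma> (a x)"
        using reals_Archimedean3[OF pos] by blast
      then show False using scaled[of "real n"] True by simp
    qed
    then show ?thesis using True by simp
  next
    case False
    then have "0 < \<gamma> x" using D(1)[of x] by simp
    then show ?thesis using scaled[of "1 / \<gamma> x"] by (simp add: field_simps)
  qed
qed

text \<open>Together with \<open>Phi_r_act\<close> this makes \<open>Phi_r s t \<gamma> a\<close>
  the least operator bound, so later arguments avoid suprema.\<close>

lemma Phi_r_least:
  assumes \<gamma>: "\<gamma> \<in> SN_tring s t" and a: "a \<in> E0r s t"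
    and K: "0 \<le> K" "\<And>x. \<gamma> (a x) \<le> K * \<gamma> x"
  shows "Phi_r s t \<gamma> a \<le> K"
proof -
  have "\<gamma> (a x) \<le> K" if "\<gamma> x \<le> 1" for x
    using K(2)[of x] mult_left_mono[OF that K(1)] by simp
  then show ?thesis
    using a bdd_above_Phi_r(1)[OF \<gamma> a] by (auto simp: Phi_r_def intro!: cSUP_least)
qed

lemma Phi_r_nonneg:
  assumes \<gamma>: "\<gamma> \<in> SN_tring s t" and a: "a \<in> E0r s t"
  shows "0 \<le> Phi_r s t \<gamma> a"
proof -
  note D = SN_tringD[OF \<gamma>]
  have "\<gamma> 0 = 0" using D(3)[of 0 0] by simp
  then have "\<gamma> (a 0) \<le> Phi_r s t \<gamma> a"
    using cSUP_upper[OF _ bdd_above_Phi_r(2)[OF \<gamma> a], of 0] a by (simp add: Phi_r_def)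
  then show ?thesis using D(1) order_trans by blast
qed

lemma Phi_r_theta_le:
  assumes \<gamma>: "\<gamma> \<in> SN_tring s t"
  shows "Phi_r s t \<gamma> (theta t x y) \<le> \<gamma> x * \<gamma> y"
  using SN_tringD(1,4)[OF \<gamma>]
  by (intro Phi_r_least[OF \<gamma> theta_in_E0r]) (auto simp: theta_def mult_ac)

text \<open>The lower bound comes from letting \<langle>x, x\<rangle> act on x itself, where
  \<gamma>((x, x, x)) = \<gamma>(x)^3.\<close>

lemma Phi_r_theta_diag:
  assumes \<gamma>: "\<gamma> \<in> SN_tring s t"
  shows "Phi_r s t \<gamma> (theta t x x) = (\<gamma> x)\<^sup>2"
proof (rule antisym)
  show "Phi_r s t \<gamma> (theta t x x) \<le> (\<gamma> x)\<^sup>2"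
    using Phi_r_theta_le[OF \<gamma>, of x x] by (simp add: power2_eq_square)
  show "(\<gamma> x)\<^sup>2 \<le> Phi_r s t \<gamma> (theta t x x)"
  proof (cases "\<gamma> x = 0")
    case False
    then have "0 < \<gamma> x" using SN_tringD(1)[OF \<gamma>, of x] by simp
    moreover have "(\<gamma> x)\<^sup>2 * \<gamma> x \<le> Phi_r s t \<gamma> (theta t x x) * \<gamma> x"
      using Phi_r_act[OF \<gamma> theta_in_E0r[of x x], of x] SN_tringD(5)[OF \<gamma>, of x]
      by (simp add: theta_def power_numeral_reduce mult_ac)
    ultimately show ?thesis by simp
  qed (use Phi_r_nonneg[OF \<gamma> theta_in_E0r] in simp)
qed

lemma Psi_r_Phi_r:
  assumes \<gamma>: "\<gamma> \<in> SN_tring s t"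
  shows "Psi_r t (Phi_r s t \<gamma>) = \<gamma>"
  by (rule ext) (simp add: Psi_r_def Phi_r_theta_diag[OF \<gamma>] SN_tringD(1)[OF \<gamma>])

lemma Phi_r_in_SN_cs:
  assumes \<gamma>: "\<gamma> \<in> SN_tring s t"
  shows "Phi_r s t \<gamma> \<in> SN_cs s t"
proof -
  let ?p = "Phi_r s t \<gamma>"
  note D = SN_tringD[OF \<gamma>] and nn = Phi_r_nonneg[OF \<gamma>] and act = Phi_r_act[OF \<gamma>]
    and least = Phi_r_least[OF \<gamma>]
  have tri: "?p (a + b) \<le> ?p a + ?p b" if ab: "a \<in> E0r s t" "b \<in> E0r s t" for a b
  proof (rule least[OF E0r_add[OF ab]])
    show "0 \<le> ?p a + ?p b" using nn ab by simp
    show "\<gamma> ((a + b) x) \<le> (?p a + ?p b) * \<gamma> x" for x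
      using D(2)[of "a x" "b x"] act[OF ab(1), of x] act[OF ab(2), of x]
      by (simp add: algebra_simps)
  qed
  have hom_le: "?p (fun_scale s c a) \<le> cmod c * ?p a" if a: "a \<in> E0r s t" for c a
  proof (rule least[OF E0r_scale[OF a]])
    show "0 \<le> cmod c * ?p a" using nn a by simp
    show "\<gamma> (fun_scale s c a x) \<le> cmod c * ?p a * \<gamma> x" for x
      using act[OF a, of x] by (simp add: fun_scale_def D(3) mult_left_mono mult.assoc)
  qed
  have hom: "?p (fun_scale s c a) = cmod c * ?p a" if a: "a \<in> E0r s t" for c a
  proof (rule antisym[OF hom_le[OF a]])
    show "cmod c * ?p a \<le> ?p (fun_scale s c a)"
    proof (cases "c = 0")
      case False
      have "fun_scale s (inverse c) (fun_scale s c a) = a"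
        using False by (simp add: fun_scale_def)
      then have "?p a \<le> cmod (inverse c) * ?p (fun_scale s c a)"
        using hom_le[OF E0r_scale[OF a], of "inverse c" c] by simp
      then show ?thesis using False by (simp add: norm_divide field_simps)
    next
      case True
      show ?thesis using nn[OF E0r_scale[OF a]] by (simp only: True norm_zero mult_zero_left)
    qed
  qed
  have mult: "?p (mult_r a b) \<le> ?p a * ?p b" if ab: "a \<in> E0r s t" "b \<in> E0r s t" for a b
  proof (rule least[OF E0r_mult[OF ab]])
    show "0 \<le> ?p a * ?p b" using nn ab by simp
    show "\<gamma> (mult_r a b x) \<le> ?p a * ?p b * \<gamma> x" for x
      using act[OF ab(2), of "a x"] mult_left_mono[OF act[OF ab(1), of x] nn[OF ab(2)]]
      by (simp add: mult_r_def mult_ac)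
  qed
  \<comment> \<open>The adjoint relation gives (xa, xa, xa) = (xaa^*, x, xa), hence \<gamma>(xa)^3
    \<le> q \<gamma>(x)^2 \<gamma>(xa) with q the operator bound of aa^*.\<close>
  have square_le: "(?p a)\<^sup>2 \<le> ?p (mult_r a (star_r s t a))" if a: "a \<in> E0r s t" for a
  proof -
    let ?q = "?p (mult_r a (star_r s t a))"
    have aa: "mult_r a (star_r s t a) \<in> E0r s t" using a by (intro E0r_mult star_r_in_E0r)
    have "\<gamma> (a x) \<le> sqrt ?q * \<gamma> x" for x
    proof (cases "\<gamma> (a x) = 0")
      case False
      then have pos: "0 < \<gamma> (a x)" using D(1)[of "a x"] by simp
      have "(\<gamma> (a x))\<^sup>2 * \<gamma> (a x) = \<gamma> (t (star_r s t a (a x)) x (a x))"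
        using D(5)[of "a x"] star_r_adjoint[OF a, of "a x" x "a x"]
        by (simp add: power_numeral_reduce mult_ac)
      also have "\<dots> \<le> \<gamma> (star_r s t a (a x)) * \<gamma> x * \<gamma> (a x)" by (rule D(4))
      also have "\<dots> \<le> (?q * \<gamma> x) * \<gamma> x * \<gamma> (a x)"
        using act[OF aa, of x] D(1) by (intro mult_right_mono) (simp_all add: mult_r_def)
      finally have "(\<gamma> (a x))\<^sup>2 \<le> ?q * \<gamma> x * \<gamma> x" using pos by simp
      also have "\<dots> = (sqrt ?q * \<gamma> x)\<^sup>2"
        using nn[OF aa] by (simp add: power_mult_distrib) (simp add: power2_eq_square)
      finally show ?thesis using nn[OF aa] D(1) by (auto intro: power2_le_imp_le)
    qed (use nn[OF aa] D(1) in simp)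
    then have "?p a \<le> sqrt ?q" using nn[OF aa] by (intro least[OF a]) auto
    then have "(?p a)\<^sup>2 \<le> (sqrt ?q)\<^sup>2" using nn[OF a] by (rule power_mono)
    then show ?thesis using nn[OF aa] by simp
  qed
  have star_le: "?p a \<le> ?p (star_r s t a)" if a: "a \<in> E0r s t" for a
  proof (cases "?p a = 0")
    case False
    then have "0 < ?p a" using nn[OF a] by simp
    moreover have "?p a * ?p a \<le> ?p a * ?p (star_r s t a)"
      using square_le[OF a] mult[OF a star_r_in_E0r[OF a]] by (simp add: power2_eq_square)
    ultimately show ?thesis by simp
  qed (use nn[OF star_r_in_E0r[OF a]] in simp)
  have cstar: "?p (mult_r (star_r s t a) a) = (?p a)\<^sup>2" if a: "a \<in> E0r s t" for a
  proof -
    have eq: "?p (star_r s t a) = ?p a"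
      using star_le[OF a] star_le[OF star_r_in_E0r[OF a]] by (simp add: star_r_star_r a)
    show ?thesis
      \<comment> \<open>\<open>square_le\<close> speaks of aa^*; used for the adjoint of
        \<open>a\<close> it becomes the required statement about a^* a.\<close>
      using square_le[OF star_r_in_E0r[OF a]] mult[OF star_r_in_E0r[OF a] a]
      by (simp add: star_r_star_r a eq power2_eq_square)
  qed
  have "(?p (theta t x y))\<^sup>2 \<le> ?p (theta t x x) * ?p (theta t y y)" for x y
    using power_mono[OF Phi_r_theta_le[OF \<gamma>, of x y] nn[OF theta_in_E0r], of 2]
    by (simp add: Phi_r_theta_diag[OF \<gamma>] power_mult_distrib)
  then show ?thesis
    using nn tri hom mult cstar
    by (auto simp: SN_cs_def SN_alg_def seminorm_on_def) (simp add: Phi_r_def)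
qed

text \<open>No supremum is computed: both sides lie in \<open>SN_cs s t\<close> and have the same
  image under \<open>Psi_r\<close>, so comparison in both directions makes them equal.\<close>

lemma Phi_r_Psi_r:
  assumes \<alpha>: "\<alpha> \<in> SN_cs s t"
  shows "Phi_r s t (Psi_r t \<alpha>) = \<alpha>"
proof -
  let ?\<beta> = "Phi_r s t (Psi_r t \<alpha>)"
  have \<beta>: "?\<beta> \<in> SN_cs s t" by (rule Phi_r_in_SN_cs[OF Psi_r_in_SN_tring[OF \<alpha>]])
  have eq: "Psi_r t ?\<beta> = Psi_r t \<alpha>" by (rule Psi_r_Phi_r[OF Psi_r_in_SN_tring[OF \<alpha>]])
  show ?thesis
  proof (rule extensionalityI[OF SN_csD(1)[OF \<beta>] SN_csD(1)[OF \<alpha>]])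
    show "?\<beta> a = \<alpha> a" if "a \<in> E0r s t" for a
      using SN_cs_le_of_Psi_r_le[OF \<alpha> \<beta> _ that] SN_cs_le_of_Psi_r_le[OF \<beta> \<alpha> _ that] eq by auto
  qed
qed

section \<open>Norms correspond to norms\<close>

lemma Phi_r_in_N_cs:
  assumes \<gamma>: "\<gamma> \<in> N_tring s t"
  shows "Phi_r s t \<gamma> \<in> N_cs s t"
proof -
  have SN: "\<gamma> \<in> SN_tring s t" and norm: "\<And>x. \<gamma> x = 0 \<Longrightarrow> x = 0"
    using \<gamma> by (auto simp: N_tring_def)
  have "a = 0" if a: "a \<in> E0r s t" and 0: "Phi_r s t \<gamma> a = 0" for a
  proof
    fix x
    have "\<gamma> (a x) = 0"
      using Phi_r_act[OF SN a, of x] SN_tringD(1)[OF SN, of "a x"] 0 by simp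
    then show "a x = 0 x" using norm by simp
  qed
  then show ?thesis
    using Phi_r_in_SN_cs[OF SN] by (auto simp: N_cs_def N_alg_def SN_cs_def)
qed

lemma Psi_r_in_N_tring:
  assumes \<alpha>: "\<alpha> \<in> N_cs s t"
  shows "Psi_r t \<alpha> \<in> N_tring s t"
proof -
  have SN: "\<alpha> \<in> SN_cs s t" and norm: "\<And>a. a \<in> E0r s t \<Longrightarrow> \<alpha> a = 0 \<Longrightarrow> a = 0"
    using \<alpha> by (auto simp: N_cs_def N_alg_def)
  have "x = 0" if "Psi_r t \<alpha> x = 0" for x
  proof -
    \<comment> \<open>Definiteness of \<alpha> yields \<langle>x, x\<rangle> = 0, hence (x, x, x) =
      0, and admissibility finishes.\<close>
    have "theta t x x = 0" using that by (intro norm theta_in_E0r) (simp add: Psi_r_def)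
    then have "t x x x = 0" by (metis theta_def zero_fun_apply)
    then show ?thesis by (rule admissible)
  qed
  then show ?thesis using Psi_r_in_SN_tring[OF SN] by (simp add: N_tring_def)
qed

end

theorem theorem3p18:
  fixes s :: "complex \<Rightarrow> 'e::ab_group_add \<Rightarrow> 'e"
    and t :: "'e \<Rightarrow> 'e \<Rightarrow> 'e \<Rightarrow> 'e"
  assumes "admissible_star_tring s t"
  shows "lattice_iso (pointwise_order UNIV (SN_tring s t))
        (pointwise_order (E0r s t) (SN_cs s t)) (Phi_r s t) \<and>
      lattice_iso (pointwise_order (E0r s t) (SN_cs s t))
        (pointwise_order UNIV (SN_tring s t)) (Psi_r t) \<and>
      (\<forall>\<gamma>\<in>SN_tring s t. Psi_r t (Phi_r s t \<gamma>) = \<gamma>) \<and>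
      (\<forall>\<alpha>\<in>SN_cs s t. Phi_r s t (Psi_r t \<alpha>) = \<alpha>) \<and>
      Phi_r s t ` N_tring s t = N_cs s t \<and>
      Psi_r t ` N_cs s t = N_tring s t"
proof -
  interpret admissible_star_tring s t by (rule assms)
  let ?L = "pointwise_order UNIV (SN_tring s t)" and ?M = "pointwise_order (E0r s t) (SN_cs s t)"
  have M: "partial_order ?M"
    by (rule partial_order_pointwise_order) (auto intro: SN_csD(1))
  \<comment> \<open>Not evident from the supremum, since a larger seminorm has a smaller unit ball.
    The comparison lemma applies because \<open>Psi_r\<close> recovers \<gamma> and
    \<delta>.\<close>
  have Phi_mono: "Phi_r s t \<gamma> \<sqsubseteq>\<^bsub>?M\<^esub> Phi_r s t \<delta>"
    if "\<gamma> \<in> carrier ?L" "\<delta> \<in> carrier ?L" "\<gamma> \<sqsubseteq>\<^bsub>?L\<^esub> \<delta>" for \<gamma> \<delta>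
  proof -
    have SN: "\<gamma> \<in> SN_tring s t" "\<delta> \<in> SN_tring s t" and le: "\<And>x. \<gamma> x \<le> \<delta> x" using that by auto
    have "Psi_r t (Phi_r s t \<gamma>) x \<le> Psi_r t (Phi_r s t \<delta>) x" for x
      unfolding Psi_r_Phi_r[OF SN(1)] Psi_r_Phi_r[OF SN(2)] by (rule le)
    from SN_cs_le_of_Psi_r_le[OF Phi_r_in_SN_cs[OF SN(1)] Phi_r_in_SN_cs[OF SN(2)] this]
    show ?thesis by simp
  qed
  have Psi_mono: "Psi_r t \<alpha> \<sqsubseteq>\<^bsub>?L\<^esub> Psi_r t \<beta>" if "\<alpha> \<sqsubseteq>\<^bsub>?M\<^esub> \<beta>" for \<alpha> \<beta>
    using that theta_in_E0r by (simp add: Psi_r_def)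
  have maps: "Phi_r s t \<in> carrier ?L \<rightarrow> carrier ?M" "Psi_r t \<in> carrier ?M \<rightarrow> carrier ?L"
    by (simp_all add: Phi_r_in_SN_cs Psi_r_in_SN_tring)
  have inverse: "\<And>\<gamma>. \<gamma> \<in> carrier ?L \<Longrightarrow> Psi_r t (Phi_r s t \<gamma>) = \<gamma>"
      "\<And>\<alpha>. \<alpha> \<in> carrier ?M \<Longrightarrow> Phi_r s t (Psi_r t \<alpha>) = \<alpha>"
    by (simp_all add: Psi_r_Phi_r Phi_r_Psi_r)
  have "lattice_iso ?L ?M (Phi_r s t)" "lattice_iso ?M ?L (Psi_r t)"
    by (rule lattice_iso_of_order_iso[OF lattice_SN_tring M maps inverse Phi_mono Psi_mono];
        assumption)+
  moreover have "Phi_r s t ` N_tring s t = N_cs s t"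
  proof (intro equalityI image_subsetI subsetI)
    fix \<alpha> assume \<alpha>: "\<alpha> \<in> N_cs s t"
    have "\<alpha> = Phi_r s t (Psi_r t \<alpha>)" using inverse(2)[of \<alpha>] \<alpha> by (simp add: N_cs_def)
    then show "\<alpha> \<in> Phi_r s t ` N_tring s t" by (rule image_eqI[OF _ Psi_r_in_N_tring[OF \<alpha>]])
  qed (rule Phi_r_in_N_cs)
  moreover have "Psi_r t ` N_cs s t = N_tring s t"
  proof (intro equalityI image_subsetI subsetI)
    fix \<gamma> assume \<gamma>: "\<gamma> \<in> N_tring s t"
    have "\<gamma> = Psi_r t (Phi_r s t \<gamma>)" using inverse(1)[of \<gamma>] \<gamma> by (simp add: N_tring_def)
    then show "\<gamma> \<in> Psi_r t ` N_cs s t" by (rule image_eqI[OF _ Phi_r_in_N_cs[OF \<gamma>]])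
  qed (rule Psi_r_in_N_tring)
  ultimately show ?thesis
    using inverse unfolding pointwise_order_simps by (intro conjI ballI) assumption+
qed

end
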